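(* Let $A$ be a finite set, let $F\colon A^{\mathbb{Z}}\to A^{\mathbb{Z}}$ be a cellular automaton, and let $\mu$ be a Borel probability measure on $A^{\mathbb{Z}}$ that is $F$-invariant (and not necessarily shift-invariant). If $F$ is $\mu$-equicontinuous, then the measure-theoretic entropy of $F$ with respect to $\mu$ is zero: $h_\mu(F)=0$.
   Context: $A^{\mathbb{Z}}$ is the set of bi-infinite sequences $x=(x_i)_{i\in\mathbb{Z}}$ with $x_i\in A$, with the product topology of the discrete topologies on $A$. The shift $\sigma\colon A^{\mathbb{Z}}\to A^{\mathbb{Z}}$ is $\sigma(x)=(x_{i+1})_{i\in\mathbb{Z}}$. A cellular automaton is a continuous map $F\colon A^{\mathbb{Z}}\to A^{\mathbb{Z}}$ commuting with $\sigma$. Here $\mathbb{N}=\{0,1,2,\dots\}$. For integers $i\le j$, $x(i,j)$ denotes the word $x_i\ldots x_j$. For an integer $n\ge 0$ and $x\in A^{\mathbb{Z}}$, let $C_n(x)=\{y\in A^{\mathbb{Z}} : y_j=x_j \text{ for all } -n\le j\le n\}$ and $B_n(x)=\{y\in A^{\mathbb{Z}} : F^i(y)(-n,n)=F^i(x)(-n,n)\text{ for all } i\in\mathbb{N}\}$. A point $x$ is $\mu$-equicontinuous if for all $m\in\mathbb{N}$, $\lim_{n\to\infty}\frac{\mu(C_n(x)\cap B_m(x))}{\mu(C_n(x))}=1$ (in particular $\mu(C_n(x))>0$ for all $n$, so that the quotients make sense). The cellular automaton $F$ is called $\mu$-equicontinuous if the set of $\mu$-equicontinuous points has full $\mu$-measure.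 $\mu$ is $F$-invariant if $\mu(F^{-1}(E))=\mu(E)$ for every Borel set $E$; $h_\mu(F)$ is the Kolmogorov–Sinai entropy of $F$ with respect to $\mu$. *)

theory Defs
  imports "HOL-Probability.Probability"
begin

text \<open>
  The alphabet is a type of sort \<open>{finite, discrete_topology}\<close>; the full shift is then the
  function type \<open>int \<Rightarrow> 'a\<close>, whose type-class topology is the product topology.
\<close>

definition shift :: "(int \<Rightarrow> 'a) \<Rightarrow> (int \<Rightarrow> 'a)" where
  "shift x = (\<lambda>i. x (i + 1))"

definition cellular_automaton ::
    "((int \<Rightarrow> 'a::{finite, discrete_topology}) \<Rightarrow> (int \<Rightarrow> 'a)) \<Rightarrow> bool" where
  "cellular_automaton F \<longleftrightarrow> continuous_on UNIV F \<and> F \<circ> shift = shift \<circ> F"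

definition cylinder :: "nat \<Rightarrow> (int \<Rightarrow> 'a) \<Rightarrow> (int \<Rightarrow> 'a) set" where
  "cylinder n x = {y. \<forall>j\<in>{- int n..int n}. y j = x j}"

definition column_class ::
    "((int \<Rightarrow> 'a) \<Rightarrow> (int \<Rightarrow> 'a)) \<Rightarrow> nat \<Rightarrow> (int \<Rightarrow> 'a) \<Rightarrow> (int \<Rightarrow> 'a) set" where
  "column_class F n x = {y. \<forall>i. \<forall>j\<in>{- int n..int n}. (F ^^ i) y j = (F ^^ i) x j}"

text \<open>Since \<open>a / 0 = 0\<close>, positivity of the denominators is stated explicitly.\<close>

definition equicontinuous_point ::
    "(int \<Rightarrow> 'a) measure \<Rightarrow> ((int \<Rightarrow> 'a) \<Rightarrow> (int \<Rightarrow> 'a)) \<Rightarrow> (int \<Rightarrow> 'a) \<Rightarrow> bool" where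
  "equicontinuous_point M F x \<longleftrightarrow>
     (\<forall>n. measure M (cylinder n x) > 0) \<and>
     (\<forall>m. (\<lambda>n. measure M (cylinder n x \<inter> column_class F m x) / measure M (cylinder n x))
            \<longlonglongrightarrow> 1)"

definition equicontinuous_ca ::
    "(int \<Rightarrow> 'a) measure \<Rightarrow> ((int \<Rightarrow> 'a) \<Rightarrow> (int \<Rightarrow> 'a)) \<Rightarrow> bool" where
  "equicontinuous_ca M F \<longleftrightarrow> (AE x in M. equicontinuous_point M F x)"

definition invariant_measure :: "'b measure \<Rightarrow> ('b \<Rightarrow> 'b) \<Rightarrow> bool" where
  "invariant_measure M T \<longleftrightarrow> (\<forall>E\<in>sets M. emeasure M (T -` E \<inter> space M) = emeasure M E)"

definition finite_measurable_partition :: "'b measure \<Rightarrow> 'b set set \<Rightarrow> bool" where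
  "finite_measurable_partition M P \<longleftrightarrow> finite P \<and> P \<subseteq> sets M \<and> partition_on (space M) P"

text \<open>Natural logarithms; \<open>ln 0 = 0\<close> yields the convention \<open>0 ln 0 = 0\<close>.\<close>

definition partition_entropy :: "'b measure \<Rightarrow> 'b set set \<Rightarrow> real" where
  "partition_entropy M P = - (\<Sum>p\<in>P. measure M p * ln (measure M p))"

text \<open>The join of the partitions \<open>(T ^^ i) -` P\<close> for \<open>0 \<le> i < n\<close>.\<close>

definition iterated_join :: "'b measure \<Rightarrow> ('b \<Rightarrow> 'b) \<Rightarrow> 'b set set \<Rightarrow> nat \<Rightarrow> 'b set set" where
  "iterated_join M T P n =
     {space M \<inter> (\<Inter>i<n. (T ^^ i) -` p i) | p. \<forall>i<n. p i \<in> P} - {{}}"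

text \<open>
  The limit exists, by subadditivity, whenever \<open>M\<close> is a \<open>T\<close>-invariant probability measure
  and \<open>T\<close> is measurable.
\<close>

definition entropy_wrt_partition :: "'b measure \<Rightarrow> ('b \<Rightarrow> 'b) \<Rightarrow> 'b set set \<Rightarrow> real" where
  "entropy_wrt_partition M T P =
     lim (\<lambda>n. partition_entropy M (iterated_join M T P n) / real n)"

definition ks_entropy :: "'b measure \<Rightarrow> ('b \<Rightarrow> 'b) \<Rightarrow> ereal" where
  "ks_entropy M T =
     (SUP P\<in>{P. finite_measurable_partition M P}. ereal (entropy_wrt_partition M T P))"

end

theory Submission
  imports Defs
begin

text \<open>
  The sets \<open>A\<close> whose itineraries (the successive truth values of \<open>(F ^^ i) x \<in> A\<close>) have entropy
  \<open>o(n)\<close> form a \<open>\<sigma>\<close>-algebra, the Pinsker algebra, and by subadditivity \<open>ks_entropy \<mu> F = 0\<close> as soon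
  as it contains every Borel set, hence as soon as it contains every cylinder.  A
  \<open>\<mu>\<close>-equicontinuous point has a column class of positive measure, so almost every point lies in
  one of countably many column classes.  All points of a column class \<open>column_class F m y\<close> have the
  same itinerary with respect to \<open>cylinder m x\<close>; finitely many classes of total measure at least
  \<open>1 - e\<close> thus contribute a bounded amount of entropy, and the remaining points at most
  \<open>1 + e + e * n * ln 2\<close>.
\<close>

section \<open>Shannon entropy of finitely valued random variables\<close>

context prob_space
begin

text \<open>The sum runs over attained values, so no target measure has to be named and every fibre
  that occurs is nonempty, as in \<open>iterated_join\<close>.\<close>

definition shannon :: "('a \<Rightarrow> 'b) \<Rightarrow> real" where
  "shannon X = - (\<Sum>v\<in>X ` space M. prob (X -` {v} \<inter> space M) * ln (prob (X -` {v} \<inter> space M)))"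

lemma information_space_exp: "information_space M (exp 1)"
  by (simp add: information_space_def information_space_axioms_def prob_space_axioms)

text \<open>Base \<open>exp 1\<close> turns the logarithm into \<open>ln\<close>; this opens the way
  to data processing and the chain rule.\<close>

lemma shannon_eq_entropy:
  assumes "simple_function M X"
  shows "shannon X = entropy (exp 1) (count_space (X ` space M)) X"
proof -
  interpret information_space M "exp 1" by (rule information_space_exp)
  show ?thesis
    unfolding shannon_def
    by (subst entropy_simple_distributed[OF simple_distributedI[OF assms measure_nonneg refl]])
       (simp add: log_def)
qed

lemma shannon_nonneg: "0 \<le> shannon X"
proof -
  have "p * ln p \<le> 0" if "0 \<le> p" "p \<le> 1" for p :: real
    using that by (cases "p = 0") (auto intro!: mult_nonneg_nonpos)
  then show ?thesis
    unfolding shannon_def by (simp add: sum_nonpos)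
qed

text \<open>Values that are not attained have empty fibres and contribute
  \<open>0 * ln 0 = 0\<close>.\<close>

lemma shannon_eq_sum:
  assumes "finite W" "X ` space M \<subseteq> W"
  shows "shannon X = - (\<Sum>v\<in>W. prob (X -` {v} \<inter> space M) * ln (prob (X -` {v} \<inter> space M)))"
proof -
  have "X -` {v} \<inter> space M = {}" if "v \<in> W - X ` space M" for v
    using that by auto
  then show ?thesis
    unfolding shannon_def using assms by (intro arg_cong[where f = uminus] sum.mono_neutral_left) auto
qed

text \<open>Data processing: on the space, \<open>Y\<close> factors through \<open>X\<close>.
  Phrasing this by equality of values spares each application an explicit factor map.\<close>

lemma shannon_determined_le:
  assumes "simple_function M X"
    and "\<And>x y. x \<in> space M \<Longrightarrow> y \<in> space M \<Longrightarrow> X x = X y \<Longrightarrow> Y x = Y y"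
  shows "simple_function M Y" "shannon Y \<le> shannon X"
proof -
  interpret information_space M "exp 1" by (rule information_space_exp)
  \<comment> \<open>\<open>Y\<close> is evaluated at a chosen preimage of \<open>v\<close>; by the
    second assumption the choice does not matter.\<close>
  define g where "g v = Y (SOME x. x \<in> space M \<and> X x = v)" for v
  have gX: "g (X x) = Y x" if "x \<in> space M" for x
  proof -
    have "(SOME y. y \<in> space M \<and> X y = X x) \<in> space M \<and> X (SOME y. y \<in> space M \<and> X y = X x) = X x"
      by (rule someI[where x = x]) (simp add: that)
    then show ?thesis
      unfolding g_def using assms(2) that by blast
  qed
  have sg: "simple_function M (g \<circ> X)"
    using assms(1) by (rule simple_function_compose)
  moreover have "simple_function M (g \<circ> X) = simple_function M Y"
    by (rule simple_function_cong) (simp add: gX)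
  ultimately show sY: "simple_function M Y"
    by blast
  have fibre: "(g \<circ> X) -` {v} \<inter> space M = Y -` {v} \<inter> space M" for v
    using gX by auto
  have img: "(g \<circ> X) ` space M = Y ` space M"
    using gX by (auto simp: image_iff)
  have "shannon Y = shannon (g \<circ> X)"
    unfolding shannon_def fibre img ..
  also have "\<dots> \<le> shannon X"
    using entropy_data_processing[OF assms(1), of g] shannon_eq_entropy[OF sg]
      shannon_eq_entropy[OF assms(1)] by simp
  finally show "shannon Y \<le> shannon X" .
qed

text \<open>Chain rule H(X,Y) = H(X) + H(Y|X), together with H(Y|X) \<le> H(Y).\<close>

lemma shannon_Pair_le:
  assumes "simple_function M X" "simple_function M Y"
  shows "shannon (\<lambda>x. (X x, Y x)) \<le> shannon X + shannon Y"
proof -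
  interpret information_space M "exp 1" by (rule information_space_exp)
  show ?thesis
    using entropy_chain_rule[OF assms] conditional_entropy_less_eq_entropy[OF assms(2,1)]
      shannon_eq_entropy[OF assms(1)] shannon_eq_entropy[OF assms(2)]
      shannon_eq_entropy[OF simple_function_Pair[OF assms]]
    by simp
qed

lemma shannon_const: "shannon (\<lambda>_. c) = 0"
proof -
  have "(\<lambda>_. c) ` space M = {c}" "(\<lambda>_. c) -` {c} \<inter> space M = space M"
    using not_empty by auto
  then show ?thesis
    by (simp add: shannon_def prob_space)
qed

text \<open>Induction on \<open>I\<close>: the new tuple is determined by its new entry and the old
  tuple. Simplicity is carried along because \<open>shannon_Pair_le\<close> asks for it.\<close>

lemma shannon_family_le:
  assumes "finite I" "\<And>i. i \<in> I \<Longrightarrow> simple_function M (X i)"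
  shows "simple_function M (\<lambda>x. \<lambda>i\<in>I. X i x) \<and> shannon (\<lambda>x. \<lambda>i\<in>I. X i x) \<le> (\<Sum>i\<in>I. shannon (X i))"
  using assms
proof (induction I rule: finite_induct)
  case empty
  then show ?case by (simp add: shannon_const)
next
  case (insert i I)
  let ?Y = "\<lambda>x. \<lambda>i\<in>I. X i x"
  have Y: "simple_function M ?Y" "shannon ?Y \<le> (\<Sum>i\<in>I. shannon (X i))"
    using insert.IH insert.prems by blast+
  have Xi: "simple_function M (X i)"
    using insert.prems by blast
  have det: "(\<lambda>i\<in>insert i I. X i x) = (\<lambda>i\<in>insert i I. X i y)"
    if "(X i x, ?Y x) = (X i y, ?Y y)" for x y
    using that by (auto simp: fun_eq_iff restrict_def split: if_splits)
  note XY = simple_function_Pair[OF Xi Y(1)]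
  have "shannon (\<lambda>x. \<lambda>i\<in>insert i I. X i x) \<le> shannon (\<lambda>x. (X i x, ?Y x))"
    by (rule shannon_determined_le(2)[OF XY det])
  also have "\<dots> \<le> (\<Sum>i\<in>insert i I. shannon (X i))"
    using shannon_Pair_le[OF Xi Y(1)] Y(2) insert(1,2) by simp
  finally have "shannon (\<lambda>x. \<lambda>i\<in>insert i I. X i x) \<le> (\<Sum>i\<in>insert i I. shannon (X i))" .
  moreover have "simple_function M (\<lambda>x. \<lambda>i\<in>insert i I. X i x)"
    by (rule shannon_determined_le(1)[OF XY det])
  ultimately show ?case by (intro conjI)
qed

lemmas simple_function_family = shannon_family_le[THEN conjunct1]
lemmas shannon_family_le_sum = shannon_family_le[THEN conjunct2]

section \<open>Entropy of events and of nearly constant variables\<close>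

lemma simple_function_mem: "A \<in> sets M \<Longrightarrow> simple_function M (\<lambda>x. x \<in> A)"
proof -
  assume "A \<in> sets M"
  moreover have "(\<lambda>x. x \<in> A) -` {v} \<inter> space M = (if v then A \<inter> space M else space M - A)" for v
    by auto
  ultimately show ?thesis
    by (auto simp: simple_function_def)
qed

text \<open>The values other than \<open>c\<close> are at most \<open>L\<close> in number and have
  total probability at most \<open>e\<close>; they cost at most \<open>d + e * ln (L / d)\<close>,
  and \<open>c\<close> itself costs at most \<open>e\<close>. The free parameter \<open>d\<close> is
  taken small for rare events and equal to 1 for long names.\<close>

lemma shannon_small_set_le:
  fixes L d e :: real
  assumes X: "simple_function M X"
    and card: "real (card (X ` space M - {c})) \<le> L"
    and d: "0 < d" "d \<le> L"
    and e: "prob {x \<in> space M. X x \<noteq> c} \<le> e"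
  shows "shannon X \<le> e + d + e * ln (L / d)"
proof -
  define p where "p v = prob (X -` {v} \<inter> space M)" for v
  define V where "V = X ` space M - {c}"
  have finV: "finite V" and fibre: "\<And>v. X -` {v} \<inter> space M \<in> sets M"
    using simple_functionD[OF X] by (auto simp: V_def)
  have L: "0 < L" using d by simp
  have c_notin: "c \<notin> V"
    by (simp add: V_def)
  have q: "prob {x \<in> space M. X x \<noteq> c} = (\<Sum>v\<in>V. p v)"
  proof -
    have "{x \<in> space M. X x \<noteq> c} = (\<Union>v\<in>V. X -` {v} \<inter> space M)"
      by (auto simp: V_def)
    then show ?thesis
      using finite_measure_finite_Union[OF finV, of "\<lambda>v. X -` {v} \<inter> space M"] fibre
      by (auto simp: p_def disjoint_family_on_def)
  qed
  \<comment> \<open>Comparison with the constant weight \<open>d / L\<close>, from \<open>ln t \<le> t - 1\<close>.\<close>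
  have bound: "- (p v * ln (p v)) \<le> p v * ln (L / d) + d / L" for v
  proof (cases "p v = 0")
    case True
    then show ?thesis using d L by simp
  next
    case False
    then have pos: "0 < p v" by (simp add: p_def order_less_le)
    have "ln (d / (L * p v)) \<le> d / (L * p v) - 1"
      using pos L d by (intro ln_le_minus_one) simp
    then have "p v * ln (d / (L * p v)) \<le> p v * (d / (L * p v) - 1)"
      using pos by simp
    also have "\<dots> = d / L - p v"
      using pos L by (simp add: field_simps)
    finally have "p v * ln (d / (L * p v)) \<le> d / L"
      using pos by simp
    moreover have "ln (d / (L * p v)) = - ln (L / d) - ln (p v)"
      using pos L d by (simp add: ln_div ln_mult)
    ultimately show ?thesis
      by (simp add: algebra_simps)
  qed
  \<comment> \<open>\<open>ln t \<le> t - 1\<close> at \<open>t = 1 / p c\<close> leaves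
    \<open>1 - p c\<close>, the probability of missing \<open>c\<close>.\<close>
  have c_term: "- (p c * ln (p c)) \<le> e"
  proof (cases "p c = 0")
    case True
    then show ?thesis using order_trans[OF measure_nonneg e] by simp
  next
    case False
    then have pos: "0 < p c" by (simp add: p_def order_less_le)
    have "ln (1 / p c) \<le> 1 / p c - 1"
      using pos by (intro ln_le_minus_one) simp
    then have "p c * ln (1 / p c) \<le> p c * (1 / p c - 1)"
      using pos by simp
    then have "- (p c * ln (p c)) \<le> 1 - p c"
      using pos by (simp add: ln_div algebra_simps)
    also have "1 - p c = prob (space M - (X -` {c} \<inter> space M))"
      using prob_compl[OF fibre] by (simp add: p_def)
    also have "space M - (X -` {c} \<inter> space M) = {x \<in> space M. X x \<noteq> c}"
      by auto
    finally show ?thesis using e by simp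
  qed
  have "shannon X = - (\<Sum>v\<in>insert c V. p v * ln (p v))"
    unfolding p_def using finV by (intro shannon_eq_sum) (auto simp: V_def)
  also have "\<dots> = - (p c * ln (p c)) + (\<Sum>v\<in>V. - (p v * ln (p v)))"
    using finV c_notin by (simp add: sum_negf)
  also have "\<dots> \<le> e + (\<Sum>v\<in>V. p v * ln (L / d) + d / L)"
    using c_term bound by (intro add_mono sum_mono)
  also have "(\<Sum>v\<in>V. p v * ln (L / d) + d / L)
      = prob {x \<in> space M. X x \<noteq> c} * ln (L / d) + real (card V) * (d / L)"
    by (simp add: q sum.distrib sum_distrib_right)
  \<comment> \<open>Since \<open>d \<le> L\<close>, the logarithm is nonnegative and the probability
    may be replaced by \<open>e\<close>.\<close>
  also have "\<dots> \<le> e * ln (L / d) + L * (d / L)"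
    using e card d L by (intro add_mono mult_right_mono) (auto simp: V_def)
  finally show ?thesis
    using L by simp
qed

lemma shannon_mem_small:
  assumes "0 < \<epsilon>"
  obtains \<delta> where "0 < \<delta>" "\<And>E. E \<in> sets M \<Longrightarrow> prob E \<le> \<delta> \<Longrightarrow> shannon (\<lambda>x. x \<in> E) \<le> \<epsilon>"
proof -
  \<comment> \<open>With \<open>L = 1\<close> the bound is
    \<open>\<delta> * (1 + ln (1 / d)) + d\<close>; each summand gets half of
    \<open>\<epsilon>\<close>, and \<open>min 1\<close> ensures \<open>d \<le> L\<close>.\<close>
  define d where "d = min 1 (\<epsilon> / 2)"
  define \<delta> where "\<delta> = (\<epsilon> / 2) / (1 + ln (1 / d))"
  have d: "0 < d" "d \<le> 1" "d \<le> \<epsilon> / 2"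
    using assms by (auto simp: d_def)
  then have ln: "0 \<le> ln (1 / d)"
    by simp
  then have pos: "0 < 1 + ln (1 / d)" by linarith
  have "shannon (\<lambda>x. x \<in> E) \<le> \<epsilon>" if "E \<in> sets M" "prob E \<le> \<delta>" for E
  proof -
    have card: "real (card ((\<lambda>x. x \<in> E) ` space M - {False})) \<le> 1"
      using card_mono[of "{True}" "(\<lambda>x. x \<in> E) ` space M - {False}"] by auto
    have E: "{x \<in> space M. x \<in> E} = E"
      using sets.sets_into_space[OF that(1)] by auto
    have "shannon (\<lambda>x. x \<in> E) \<le> \<delta> + d + \<delta> * ln (1 / d)"
      using shannon_small_set_le[OF simple_function_mem[OF that(1)] card d(1,2), of \<delta>] that(2)
      by (simp add: E)
    also have "\<dots> = \<delta> * (1 + ln (1 / d)) + d"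
      by (simp add: distrib_left)
    also have "\<dots> = \<epsilon> / 2 + d"
      using pos by (metis \<delta>_def less_irrefl nonzero_eq_divide_eq)
    finally show ?thesis using d by simp
  qed
  moreover have "0 < \<delta>"
    using assms pos by (simp add: \<delta>_def)
  ultimately show ?thesis
    using that by blast
qed

section \<open>Countable families of events\<close>

lemma prob_UN_approx:
  fixes A :: "nat \<Rightarrow> 'a set"
  assumes "range A \<subseteq> sets M" "0 < \<delta>"
  obtains k where "prob ((\<Union>i. A i) - (\<Union>i<k. A i)) \<le> \<delta>"
proof -
  have A: "\<And>i. A i \<in> sets M" using assms(1) by auto
  have "(\<lambda>k. prob (\<Union>i<k. A i)) \<longlonglongrightarrow> prob (\<Union>k. \<Union>i<k. A i)"
    by (rule finite_Lim_measure_incseq) (force simp: incseq_def A)+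
  moreover have "(\<Union>k. \<Union>i<k. A i) = (\<Union>i. A i)"
    by auto
  ultimately have "eventually (\<lambda>k. prob (\<Union>i. A i) - \<delta> < prob (\<Union>i<k. A i)) sequentially"
    using assms(2) by (intro order_tendstoD(1)) auto
  then obtain k where k: "prob (\<Union>i. A i) - \<delta> < prob (\<Union>i<k. A i)"
    by (auto simp: eventually_sequentially)
  have "prob ((\<Union>i. A i) - (\<Union>i<k. A i)) = prob (\<Union>i. A i) - prob (\<Union>i<k. A i)"
    using A by (intro finite_measure_Diff) auto
  with k show ?thesis
    by (intro that[of k]) simp
qed

text \<open>Finite subfamilies have total probability at most 1, so \<open>prob\<close> is summable
  over the family, and a summable family has only countably many nonzero terms.\<close>

lemma countable_disjoint_positive:
  assumes "\<K> \<subseteq> sets M" "disjoint \<K>" "\<And>K. K \<in> \<K> \<Longrightarrow> 0 < prob K"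
  shows "countable \<K>"
proof -
  have "sum prob \<F> \<le> 1" if "finite \<F>" "\<F> \<subseteq> \<K>" for \<F>
  proof -
    have "disjoint_family_on (\<lambda>K. K) \<F>"
      using assms(2) that by (auto simp: disjoint_family_on_def disjoint_def)
    then have "sum prob \<F> = prob (\<Union>K\<in>\<F>. K)"
      using that assms(1) by (intro finite_measure_finite_Union[symmetric]) auto
    then show ?thesis by simp
  qed
  then have "prob summable_on \<K>"
    by (intro nonneg_bdd_above_summable_on) (auto simp: bdd_above_def)
  then have "countable {K \<in> \<K>. prob K \<noteq> 0}"
    by (rule summable_countable_real)
  moreover have "{K \<in> \<K>. prob K \<noteq> 0} = \<K>"
    using assms(3) by fastforce
  ultimately show ?thesis by simp
qed

end

section \<open>Observables of zero entropy\<close>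

locale measure_preserving_system = prob_space M for M :: "'a measure" +
  fixes T :: "'a \<Rightarrow> 'a"
  assumes T_measurable[measurable]: "T \<in> measurable M M"
    and T_invariant: "invariant_measure M T"
begin

text \<open>The restriction fixes the value at indices from \<open>n\<close> on, so equality of
  names is agreement at the first \<open>n\<close> times.\<close>

definition orbit_name :: "('a \<Rightarrow> 'b) \<Rightarrow> nat \<Rightarrow> 'a \<Rightarrow> nat \<Rightarrow> 'b" where
  "orbit_name f n x = (\<lambda>i\<in>{..<n}. f ((T ^^ i) x))"

text \<open>Demanding convergence to 0 avoids a separate proof that the limit exists. For membership
  in a measurable set this defines the Pinsker algebra.\<close>

definition zero_entropy :: "('a \<Rightarrow> 'b) \<Rightarrow> bool" where
  "zero_entropy f \<longleftrightarrow> (\<lambda>n. shannon (orbit_name f n) / real n) \<longlonglongrightarrow> 0"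

lemma orbit_name_eq_iff:
  "orbit_name f n x = orbit_name f n y \<longleftrightarrow> (\<forall>i<n. f ((T ^^ i) x) = f ((T ^^ i) y))"
  by (auto simp: orbit_name_def fun_eq_iff restrict_def)

lemma funpow_measurable[measurable]: "T ^^ i \<in> measurable M M"
  by (induction i) auto

lemma funpow_space: "x \<in> space M \<Longrightarrow> (T ^^ i) x \<in> space M"
  using measurable_space[OF funpow_measurable] .

lemma shannon_funpow:
  assumes "simple_function M f"
  shows "simple_function M (\<lambda>x. f ((T ^^ i) x)) \<and> shannon (\<lambda>x. f ((T ^^ i) x)) = shannon f"
proof (induction i)
  case 0
  then show ?case using assms by simp
next
  case (Suc i)
  let ?g = "\<lambda>x. f ((T ^^ i) x)"
  have g: "simple_function M ?g" "shannon ?g = shannon f"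
    using Suc by auto
  have eq: "(\<lambda>x. f ((T ^^ Suc i) x)) = (\<lambda>x. ?g (T x))"
    by (simp add: funpow_swap1)
  have sg: "simple_function M (\<lambda>x. ?g (T x))"
    using T_measurable g(1) by (rule simple_function_comp)
  have "prob ((\<lambda>x. ?g (T x)) -` {v} \<inter> space M) = prob (?g -` {v} \<inter> space M)" for v
  proof -
    have eq: "(\<lambda>x. ?g (T x)) -` {v} \<inter> space M = T -` (?g -` {v} \<inter> space M) \<inter> space M"
      using measurable_space[OF T_measurable] by auto
    have "?g -` {v} \<inter> space M \<in> sets M"
      using simple_functionD(2)[OF g(1)] .
    then have "emeasure M (T -` (?g -` {v} \<inter> space M) \<inter> space M) = emeasure M (?g -` {v} \<inter> space M)"
      using T_invariant unfolding invariant_measure_def by blast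
    then show ?thesis
      unfolding eq measure_def by (rule arg_cong)
  qed
  \<comment> \<open>\<open>T\<close> may fail to be onto, so composition can lose values;
    \<open>shannon_eq_sum\<close> lets both sums run over the larger image.\<close>
  moreover have "(\<lambda>x. ?g (T x)) ` space M \<subseteq> ?g ` space M"
    using measurable_space[OF T_measurable] by auto
  ultimately have "shannon (\<lambda>x. ?g (T x)) = shannon ?g"
    using shannon_eq_sum[OF simple_functionD(1)[OF g(1)], of "\<lambda>x. ?g (T x)"]
    by (simp add: shannon_def[of ?g])
  then show ?case
    unfolding eq using sg g(2) by simp
qed

lemma simple_function_orbit_name: "simple_function M f \<Longrightarrow> simple_function M (orbit_name f n)"
  unfolding orbit_name_def[abs_def]
  by (rule simple_function_family) (auto simp: shannon_funpow)

lemma shannon_orbit_name_le: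
  assumes "simple_function M f"
  shows "shannon (orbit_name f n) \<le> real n * shannon f"
proof -
  have "shannon (orbit_name f n) \<le> (\<Sum>i<n. shannon (\<lambda>x. f ((T ^^ i) x)))"
    unfolding orbit_name_def[abs_def]
    by (rule shannon_family_le_sum) (auto simp: shannon_funpow assms)
  then show ?thesis
    by (simp add: shannon_funpow[OF assms])
qed

text \<open>Applying \<open>det\<close> at each time shows that the names of all \<open>g i\<close>
  together determine the name of \<open>f\<close>.\<close>

lemma orbit_name_family_le:
  assumes "finite I" "\<And>i. i \<in> I \<Longrightarrow> simple_function M (g i)"
    and det: "\<And>x y. x \<in> space M \<Longrightarrow> y \<in> space M \<Longrightarrow> \<forall>i\<in>I. g i x = g i y \<Longrightarrow> f x = f y"
  shows "shannon (orbit_name f n) \<le> (\<Sum>i\<in>I. shannon (orbit_name (g i) n))"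
proof -
  let ?G = "\<lambda>x. \<lambda>i\<in>I. orbit_name (g i) n x"
  have G: "simple_function M ?G" "shannon ?G \<le> (\<Sum>i\<in>I. shannon (orbit_name (g i) n))"
    using shannon_family_le[OF assms(1), of "\<lambda>i. orbit_name (g i) n"]
    by (auto simp: simple_function_orbit_name assms(2))
  have "orbit_name f n x = orbit_name f n y"
    if xy: "x \<in> space M" "y \<in> space M" and eq: "?G x = ?G y" for x y
  proof -
    have "orbit_name (g i) n x = orbit_name (g i) n y" if "i \<in> I" for i
      using fun_cong[OF eq, of i] that by simp
    then show ?thesis
      using det funpow_space xy by (auto simp: orbit_name_eq_iff)
  qed
  then have "shannon (orbit_name f n) \<le> shannon ?G"
    by (rule shannon_determined_le(2)[OF G(1)])
  with G(2) show ?thesis by simp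
qed

lemma zero_entropyI:
  assumes "\<And>\<epsilon>. 0 < \<epsilon> \<Longrightarrow> \<forall>\<^sub>F n in sequentially. shannon (orbit_name f n) / real n \<le> \<epsilon>"
  shows "zero_entropy f"
  unfolding zero_entropy_def
proof (rule order_tendstoI)
  fix a :: real assume "a < 0"
  then show "\<forall>\<^sub>F n in sequentially. a < shannon (orbit_name f n) / real n"
    by (intro always_eventually allI order.strict_trans2[OF _ divide_nonneg_nonneg] shannon_nonneg) auto
next
  fix a :: real assume "0 < a"
  then have "\<forall>\<^sub>F n in sequentially. shannon (orbit_name f n) / real n \<le> a / 2"
    by (intro assms) simp
  then show "\<forall>\<^sub>F n in sequentially. shannon (orbit_name f n) / real n < a"
    by eventually_elim (use \<open>0 < a\<close> in linarith)
qed

text \<open>A finite sum of o(n) terms is o(n). This yields closure under complements and the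
  passage from sets to finite partitions.\<close>

lemma zero_entropy_family:
  assumes "finite I" "\<And>i. i \<in> I \<Longrightarrow> simple_function M (g i)" "\<And>i. i \<in> I \<Longrightarrow> zero_entropy (g i)"
    and "\<And>x y. x \<in> space M \<Longrightarrow> y \<in> space M \<Longrightarrow> \<forall>i\<in>I. g i x = g i y \<Longrightarrow> f x = f y"
  shows "zero_entropy f"
  unfolding zero_entropy_def
proof (rule tendsto_sandwich[OF _ _ tendsto_const])
  have "(\<lambda>n. \<Sum>i\<in>I. shannon (orbit_name (g i) n) / real n) \<longlonglongrightarrow> (\<Sum>i\<in>I. 0)"
    using assms(3) by (intro tendsto_sum) (simp add: zero_entropy_def)
  then show "(\<lambda>n. \<Sum>i\<in>I. shannon (orbit_name (g i) n) / real n) \<longlonglongrightarrow> 0"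
    by simp
  show "\<forall>\<^sub>F n in sequentially. 0 \<le> shannon (orbit_name f n) / real n"
    by (simp add: shannon_nonneg)
  show "\<forall>\<^sub>F n in sequentially.
      shannon (orbit_name f n) / real n \<le> (\<Sum>i\<in>I. shannon (orbit_name (g i) n) / real n)"
    unfolding sum_divide_distrib[symmetric]
    by (intro always_eventually allI divide_right_mono orbit_name_family_le assms) auto
qed

text \<open>
  The name of the union is determined by the names of \<open>A 0, \<dots>, A (k - 1)\<close> and of the remainder
  \<open>E\<close>; the latter costs at most \<open>n * shannon E\<close>, and \<open>E\<close> has small measure for large \<open>k\<close>.
\<close>

lemma zero_entropy_UN:
  fixes A :: "nat \<Rightarrow> 'a set"
  assumes A: "\<And>i. A i \<in> sets M" and zero: "\<And>i. zero_entropy (\<lambda>x. x \<in> A i)"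
  shows "zero_entropy (\<lambda>x. x \<in> (\<Union>i. A i))"
proof (rule zero_entropyI)
  fix \<epsilon> :: real assume "0 < \<epsilon>"
  then obtain \<delta> where \<delta>: "0 < \<delta>"
    "\<And>E. E \<in> sets M \<Longrightarrow> prob E \<le> \<delta> \<Longrightarrow> shannon (\<lambda>x. x \<in> E) \<le> \<epsilon> / 2"
    using shannon_mem_small[of "\<epsilon> / 2"] by auto
  obtain k where k: "prob ((\<Union>i. A i) - (\<Union>i<k. A i)) \<le> \<delta>"
    using prob_UN_approx[OF _ \<delta>(1), of A] A by blast
  define E where "E = (\<Union>i. A i) - (\<Union>i<k. A i)"
  have E: "E \<in> sets M" using A by (auto simp: E_def)
  \<comment> \<open>Index \<open>k\<close> stands for the remainder \<open>E\<close>, so that one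
    family over \<open>{..k}\<close> carries all the information.\<close>
  define g where "g i = (\<lambda>x. x \<in> (if i < k then A i else E))" for i
  have g: "simple_function M (g i)" for i
    unfolding g_def using A E by (intro simple_function_mem) auto
  have det: "x \<in> (\<Union>i. A i) \<longleftrightarrow> y \<in> (\<Union>i. A i)" if "\<forall>i\<in>{..k}. g i x = g i y" for x y
  proof -
    have *: "x \<in> (\<Union>i. A i) \<longleftrightarrow> (\<exists>i<k. g i x) \<or> g k x" for x
    proof -
      have "x \<in> (\<Union>i. A i) \<longleftrightarrow> x \<in> (\<Union>i<k. A i) \<or> x \<in> E"
        unfolding E_def by blast
      then show ?thesis by (auto simp: g_def)
    qed
    have "\<forall>i<k. g i x = g i y" "g k x = g k y"
      using that by auto
    then show ?thesis unfolding * by auto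
  qed
  have bound: "shannon (orbit_name (\<lambda>x. x \<in> (\<Union>i. A i)) n) / real n
      \<le> (\<Sum>i<k. shannon (orbit_name (g i) n) / real n) + \<epsilon> / 2" for n
  proof -
    have "shannon (orbit_name (\<lambda>x. x \<in> (\<Union>i. A i)) n) \<le> (\<Sum>i\<in>{..k}. shannon (orbit_name (g i) n))"
      using det by (intro orbit_name_family_le g) auto
    also have "\<dots> = (\<Sum>i<k. shannon (orbit_name (g i) n)) + shannon (orbit_name (\<lambda>x. x \<in> E) n)"
      by (simp add: lessThan_Suc_atMost[symmetric] g_def)
    also have "shannon (orbit_name (\<lambda>x. x \<in> E) n) \<le> real n * shannon (\<lambda>x. x \<in> E)"
      by (intro shannon_orbit_name_le simple_function_mem E)
    also have "\<dots> \<le> real n * (\<epsilon> / 2)"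
      using \<delta>(2)[OF E] k by (intro mult_left_mono) (auto simp: E_def)
    finally have "shannon (orbit_name (\<lambda>x. x \<in> (\<Union>i. A i)) n) / real n
        \<le> ((\<Sum>i<k. shannon (orbit_name (g i) n)) + real n * (\<epsilon> / 2)) / real n"
      by (intro divide_right_mono) auto
    \<comment> \<open>Only an inequality: for \<open>n = 0\<close> the quotients are 0, but
      \<open>\<epsilon> / 2\<close> remains on the right.\<close>
    also have "\<dots> \<le> (\<Sum>i<k. shannon (orbit_name (g i) n) / real n) + \<epsilon> / 2"
      using \<open>0 < \<epsilon>\<close> by (cases "n = 0") (auto simp: add_divide_distrib sum_divide_distrib)
    finally show ?thesis .
  qed
  have "(\<lambda>n. shannon (orbit_name (g i) n) / real n) \<longlonglongrightarrow> 0" if "i \<in> {..<k}" for i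
    using zero[of i] that by (simp add: zero_entropy_def g_def)
  then have "(\<lambda>n. \<Sum>i<k. shannon (orbit_name (g i) n) / real n) \<longlonglongrightarrow> (\<Sum>i<k. 0)"
    by (intro tendsto_sum) simp
  then have "\<forall>\<^sub>F n in sequentially. (\<Sum>i<k. shannon (orbit_name (g i) n) / real n) < \<epsilon> / 2"
    using \<open>0 < \<epsilon>\<close> by (intro order_tendstoD) auto
  then show "\<forall>\<^sub>F n in sequentially. shannon (orbit_name (\<lambda>x. x \<in> (\<Union>i. A i)) n) / real n \<le> \<epsilon>"
  proof eventually_elim
    case (elim n)
    then show ?case using bound[of n] by linarith
  qed
qed

text \<open>Induction over the generated \<sigma>-algebra, with measurability in the claim because
  the complement and union steps use it.\<close>

lemma zero_entropy_sigma_sets: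
  assumes gen: "\<And>A. A \<in> \<G> \<Longrightarrow> A \<in> sets M \<and> zero_entropy (\<lambda>x. x \<in> A)"
    and "A \<in> sigma_sets (space M) \<G>"
  shows "A \<in> sets M \<and> zero_entropy (\<lambda>x. x \<in> A)"
  using assms(2)
proof induction
  case (Basic A)
  then show ?case by (rule gen)
next
  case Empty
  have "zero_entropy (\<lambda>x. x \<in> {})"
    by (rule zero_entropy_family[where I = "{}" and g = "\<lambda>_ x. x"]) auto
  then show ?case by simp
next
  case (Compl A)
  have "zero_entropy (\<lambda>x. x \<in> space M - A)"
    by (rule zero_entropy_family[where I = "{()}" and g = "\<lambda>_ x. x \<in> A"])
       (use Compl simple_function_mem in auto)
  then show ?case using Compl by auto
next
  case (Union A)
  then show ?case using zero_entropy_UN[of A] by auto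
qed

text \<open>
  If finitely many sets on which all iterates of \<open>f\<close> are constant fill the space up to a set of
  measure \<open>e\<close>, then only the names of points in this exceptional set contribute entropy that
  grows with \<open>n\<close>, namely at most \<open>e * ln (k ^ n)\<close> for a \<open>k\<close>-valued \<open>f\<close>.
\<close>

lemma zero_entropy_constant_on_cover:
  fixes K :: "nat \<Rightarrow> 'a set"
  assumes f: "simple_function M f"
    and K: "\<And>j. K j \<in> sets M"
    and const: "\<And>j i x y. x \<in> K j \<Longrightarrow> y \<in> K j \<Longrightarrow> f ((T ^^ i) x) = f ((T ^^ i) y)"
    and cover: "AE x in M. x \<in> (\<Union>j. K j)"
  shows "zero_entropy f"
proof (rule zero_entropyI)
  fix \<epsilon> :: real assume \<epsilon>: "0 < \<epsilon>"
  define k where "k = card (f ` space M)"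
  have finf: "finite (f ` space M)" using f by (rule simple_functionD)
  have k: "1 \<le> k"
    using finf not_empty by (simp add: k_def Suc_le_eq card_gt_0_iff)
  then have lnk: "0 \<le> ln (real k)" by simp
  \<comment> \<open>The summand 1 keeps the denominator positive when \<open>f\<close> is constant
    and \<open>ln (real k) = 0\<close>.\<close>
  define e where "e = (\<epsilon> / 2) / (1 + ln (real k))"
  have e: "0 < e" "e * ln (real k) \<le> \<epsilon> / 2"
    using \<epsilon> lnk by (auto simp: e_def field_simps)
  obtain N where N: "prob ((\<Union>j. K j) - (\<Union>j<N. K j)) \<le> e"
    using prob_UN_approx[OF _ e(1), of K] K by blast
  define U where "U = (\<Union>j<N. K j)"
  have U: "U \<in> sets M" using K by (auto simp: U_def)
  have small: "prob {x \<in> space M. x \<notin> U} \<le> e"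
  proof -
    have "prob {x \<in> space M. x \<notin> U} = prob ((\<Union>j. K j) - (\<Union>j<N. K j))"
    proof (rule finite_measure_eq_AE)
      show "AE x in M. x \<in> {x \<in> space M. x \<notin> U} \<longleftrightarrow> x \<in> (\<Union>j. K j) - (\<Union>j<N. K j)"
        using cover by eventually_elim (use K sets.sets_into_space in \<open>auto simp: U_def\<close>)
      show "(\<Union>j. K j) - (\<Union>j<N. K j) \<in> sets M" using K by auto
    qed (use U in measurable)
    with N show ?thesis by simp
  qed
  \<comment> \<open>\<open>Z\<close> records which of the first \<open>N\<close> sets contain the
    point; its entropy does not depend on \<open>n\<close>.\<close>
  define Z where "Z x = (\<lambda>j\<in>{..<N}. x \<in> K j)" for x
  have Z: "simple_function M Z"
    unfolding Z_def[abs_def] by (rule simple_function_family) (auto intro: simple_function_mem K)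
  define C where "C = shannon Z + e + 1"
  have bound: "shannon (orbit_name f n) \<le> C + real n * (\<epsilon> / 2)" for n
  proof -
    \<comment> \<open>\<open>None\<close> marks the points of \<open>U\<close>, whose names
      \<open>Z\<close> already determines; elsewhere \<open>Y\<close> carries the full name.\<close>
    define Y where "Y x = (if x \<in> U then None else Some (orbit_name f n x))" for x
    have Y: "simple_function M Y"
      by (rule shannon_determined_le(1)[OF simple_function_Pair[OF
            simple_function_mem[OF U] simple_function_orbit_name[OF f, of n]]])
         (auto simp: Y_def)
    have "card (Y ` space M - {None}) \<le> k ^ n"
    proof -
      have "Y ` space M - {None} \<subseteq> Some ` ({..<n} \<rightarrow>\<^sub>E f ` space M)"
        using funpow_space by (auto simp: Y_def orbit_name_def)
      then have "card (Y ` space M - {None}) \<le> card (Some ` ({..<n} \<rightarrow>\<^sub>E f ` space M))"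
        using finf by (intro card_mono finite_imageI[OF finite_PiE]) auto
      also have "\<dots> = k ^ n"
        by (simp add: card_image card_PiE k_def)
      finally show ?thesis .
    qed
    then have card: "real (card (Y ` space M - {None})) \<le> real (k ^ n)"
      using of_nat_le_iff by blast
    have "{x \<in> space M. Y x \<noteq> None} = {x \<in> space M. x \<notin> U}"
      by (auto simp: Y_def)
    \<comment> \<open>Here \<open>L = k ^ n\<close> and \<open>d = 1\<close>;
      \<open>1 \<le> k\<close> gives \<open>d \<le> L\<close>.\<close>
    then have "shannon Y \<le> e + 1 + e * ln (real (k ^ n) / 1)"
      using k small by (intro shannon_small_set_le[OF Y card]) auto
    also have "\<dots> = e + 1 + real n * (e * ln (real k))"
      using k by (simp add: ln_realpow)
    also have "\<dots> \<le> e + 1 + real n * (\<epsilon> / 2)"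
      using e by (intro add_mono mult_left_mono) auto
    finally have shY: "shannon Y \<le> e + 1 + real n * (\<epsilon> / 2)" .
    have det: "orbit_name f n x = orbit_name f n y" if eq: "(Z x, Y x) = (Z y, Y y)" for x y
    proof (cases "x \<in> U")
      case True
      then obtain j where j: "j < N" "x \<in> K j" by (auto simp: U_def)
      have "Z x j = Z y j" using eq by simp
      then have "y \<in> K j" using j by (simp add: Z_def)
      then show ?thesis
        using const[of x j y] j by (simp add: orbit_name_eq_iff)
    next
      case False
      then show ?thesis using eq by (auto simp: Y_def split: if_splits)
    qed
    have "shannon (orbit_name f n) \<le> shannon (\<lambda>x. (Z x, Y x))"
      by (rule shannon_determined_le(2)[OF simple_function_Pair[OF Z Y] det])
    also have "\<dots> \<le> shannon Z + shannon Y"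
      by (rule shannon_Pair_le[OF Z Y])
    finally show ?thesis using shY by (simp add: C_def)
  qed
  have "(\<lambda>n. C / real n) \<longlonglongrightarrow> 0"
    by (rule lim_const_over_n)
  then have "\<forall>\<^sub>F n in sequentially. C / real n < \<epsilon> / 2"
    using \<epsilon> by (intro order_tendstoD) auto
  then show "\<forall>\<^sub>F n in sequentially. shannon (orbit_name f n) / real n \<le> \<epsilon>"
    using eventually_gt_at_top[of 0]
  proof eventually_elim
    case (elim n)
    have "shannon (orbit_name f n) / real n \<le> (C + real n * (\<epsilon> / 2)) / real n"
      by (intro divide_right_mono bound) simp
    also have "\<dots> = C / real n + \<epsilon> / 2"
      using elim by (simp add: add_divide_distrib)
    also have "\<dots> \<le> \<epsilon>"
      using elim(1) by linarith
    finally show ?case .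
  qed
qed

section \<open>Entropy of partitions\<close>

text \<open>\<open>f\<close> sends a point to the singleton of its cell, hence the nonempty cells of
  the join are exactly the fibres of the orbit name. This form of \<open>f\<close> makes it visibly
  a function of finitely many memberships.\<close>

lemma partition_entropy_iterated_join:
  assumes P: "finite_measurable_partition M P"
  defines "f \<equiv> \<lambda>x. {p \<in> P. x \<in> p}"
  shows "partition_entropy M (iterated_join M T P n) = shannon (orbit_name f n)"
proof -
  let ?X = "orbit_name f n"
  let ?fibre = "\<lambda>v. ?X -` {v} \<inter> space M"
  have part: "partition_on (space M) P"
    using P by (simp add: finite_measurable_partition_def)
  have f_mem: "f x = {p} \<longleftrightarrow> x \<in> p" if "x \<in> space M" "p \<in> P" for x p
  proof -
    have "q = p" if "q \<in> P" "x \<in> q" "x \<in> p" for q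
      using partition_onD2[OF part] that \<open>p \<in> P\<close> by (auto simp: disjoint_def)
    then show ?thesis using that by (auto simp: f_def)
  qed
  have ex_p: "\<exists>p\<in>P. f x = {p}" if "x \<in> space M" for x
  proof -
    obtain p where "p \<in> P" "x \<in> p"
      using partition_onD1[OF part] \<open>x \<in> space M\<close> by auto
    with f_mem[OF that] show ?thesis by (intro bexI[of _ p]) auto
  qed
  have cell: "space M \<inter> (\<Inter>i<n. (T ^^ i) -` p i) = ?fibre (?X x)"
    if x: "x \<in> space M" and p: "\<And>i. i < n \<Longrightarrow> p i \<in> P \<and> f ((T ^^ i) x) = {p i}" for p x
  proof -
    have "(T ^^ i) y \<in> p i \<longleftrightarrow> f ((T ^^ i) y) = f ((T ^^ i) x)" if "y \<in> space M" "i < n" for y i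
      using f_mem[OF funpow_space[OF that(1)], of "p i" i] p[OF that(2)] by simp
    then show ?thesis
      by (auto simp: orbit_name_eq_iff)
  qed
  have join: "iterated_join M T P n = ?fibre ` ?X ` space M"
  proof (intro set_eqI iffI)
    fix Q assume "Q \<in> iterated_join M T P n"
    then obtain p where Q: "Q = space M \<inter> (\<Inter>i<n. (T ^^ i) -` p i)" "Q \<noteq> {}"
      and p: "\<forall>i<n. p i \<in> P"
      by (auto simp: iterated_join_def)
    then obtain x where x: "x \<in> space M" "\<forall>i<n. (T ^^ i) x \<in> p i"
      by auto
    then have "Q = ?fibre (?X x)"
      unfolding Q(1) using p f_mem[OF funpow_space[OF x(1)]] by (intro cell) auto
    then show "Q \<in> ?fibre ` ?X ` space M"
      using x by blast
  next
    fix Q assume "Q \<in> ?fibre ` ?X ` space M"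
    then obtain x where x: "x \<in> space M" "Q = ?fibre (?X x)"
      by auto
    obtain p where p: "\<And>i. p i \<in> P \<and> f ((T ^^ i) x) = {p i}"
      using ex_p[OF funpow_space[OF x(1)]] by metis
    have "Q = space M \<inter> (\<Inter>i<n. (T ^^ i) -` p i)"
      unfolding x(2) using p by (intro cell[symmetric] x(1)) auto
    moreover have "x \<in> Q" using x by auto
    ultimately show "Q \<in> iterated_join M T P n"
      using p by (auto simp: iterated_join_def)
  qed
  \<comment> \<open>Fibres over distinct attained values are nonempty and disjoint, so the sum over
    cells can be reindexed by names.\<close>
  have "inj_on ?fibre (?X ` space M)"
    by (rule inj_onI) blast
  then show ?thesis
    unfolding partition_entropy_def join shannon_def by (subst sum.reindex) auto
qed

lemma ks_entropy_eq_0: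
  assumes zero: "\<And>A. A \<in> sets M \<Longrightarrow> zero_entropy (\<lambda>x. x \<in> A)"
  shows "ks_entropy M T = 0"
proof -
  have "entropy_wrt_partition M T P = 0" if P: "finite_measurable_partition M P" for P
  proof -
    have P': "finite P" "\<And>p. p \<in> P \<Longrightarrow> p \<in> sets M"
      using P by (auto simp: finite_measurable_partition_def)
    have "zero_entropy (\<lambda>x. {p \<in> P. x \<in> p})"
      by (rule zero_entropy_family[where g = "\<lambda>p x. x \<in> p", OF P'(1)
            simple_function_mem[OF P'(2)] zero[OF P'(2)]]) auto
    then show ?thesis
      unfolding entropy_wrt_partition_def partition_entropy_iterated_join[OF P] zero_entropy_def
      by (rule limI)
  qed
  \<comment> \<open>The supremum must range over a nonempty set: in \<open>ereal\<close> the empty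
    one would be minus infinity.\<close>
  moreover have "finite_measurable_partition M {space M}"
    using not_empty by (auto simp: finite_measurable_partition_def partition_on_def)
  ultimately show ?thesis
    unfolding ks_entropy_def by (intro SUP_eq_const) (auto simp: zero_ereal_def)
qed

end

section \<open>Cylinders and column classes\<close>

lemma open_coordinate: "open {y :: int \<Rightarrow> 'a::discrete_topology. y j = c}"
proof -
  have "open ((\<lambda>y :: int \<Rightarrow> 'a. y j) -` {c})"
    by (rule open_vimage[OF discrete_topology_class.open_discrete continuous_on_product_coordinates])
  then show ?thesis by (simp add: vimage_def)
qed

lemma borel_cylinder:
  fixes x :: "int \<Rightarrow> 'a::discrete_topology"
  shows "cylinder n x \<in> sets borel"
proof -
  have "cylinder n x = (\<Inter>j\<in>{- int n..int n}. {y. y j = x j})"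
    by (auto simp: cylinder_def)
  then show ?thesis
    by (auto intro!: sets.finite_INT borel_open open_coordinate)
qed

text \<open>A basic open set of the product restricts only finitely many coordinates, and a large
  enough window contains them all.\<close>

lemma open_contains_cylinder:
  fixes U :: "(int \<Rightarrow> 'a::topological_space) set"
  assumes "open U" "x \<in> U"
  obtains n where "cylinder n x \<subseteq> U"
proof -
  have "openin (product_topology (\<lambda>i::int. euclidean :: 'a topology) UNIV) U"
    using assms(1) by (simp add: open_fun_def)
  from product_topology_open_contains_basis[OF this assms(2)]
  obtain X where X: "x \<in> (\<Pi>\<^sub>E i\<in>UNIV. X i)" "finite {i. X i \<noteq> UNIV}" "(\<Pi>\<^sub>E i\<in>UNIV. X i) \<subseteq> U"
    by auto
  define n where "n = Max (insert 0 ((\<lambda>i. nat \<bar>i\<bar>) ` {i. X i \<noteq> UNIV}))"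
  have bound: "nat \<bar>i\<bar> \<le> n" if "X i \<noteq> UNIV" for i
    unfolding n_def using X(2) that by (intro Max_ge) auto
  have "cylinder n x \<subseteq> (\<Pi>\<^sub>E i\<in>UNIV. X i)"
  proof
    fix y assume y: "y \<in> cylinder n x"
    have "y i \<in> X i" for i
    proof (cases "X i = UNIV")
      case False
      have "i \<in> {- int n..int n}"
        using bound[OF False] by auto
      then have "y i = x i"
        using y by (simp add: cylinder_def)
      then show ?thesis using X(1) by auto
    qed simp
    then show "y \<in> (\<Pi>\<^sub>E i\<in>UNIV. X i)" by auto
  qed
  then show ?thesis
    using that X(3) by blast
qed

lemma countable_cylinders: "countable {cylinder n x | n (x :: int \<Rightarrow> 'a::finite). True}"
proof -
  have "finite (range (cylinder n :: (int \<Rightarrow> 'a) \<Rightarrow> _))" for n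
  proof -
    \<comment> \<open>Restricted sequences represent all cylinders of a given window, and over a
      finite alphabet there are finitely many of them.\<close>
    have "cylinder n x = cylinder n (restrict x {- int n..int n})" for x :: "int \<Rightarrow> 'a"
      by (auto simp: cylinder_def)
    then have "range (cylinder n :: (int \<Rightarrow> 'a) \<Rightarrow> _) \<subseteq> cylinder n ` ({- int n..int n} \<rightarrow>\<^sub>E UNIV)"
      by (metis (no_types, lifting) UNIV_I image_eqI image_subsetI restrict_PiE_iff)
    then show ?thesis
      by (rule finite_subset) (intro finite_imageI finite_PiE, auto)
  qed
  then have "countable (\<Union>n. range (cylinder n :: (int \<Rightarrow> 'a) \<Rightarrow> _))"
    by (intro countable_UN) (auto intro: countable_finite)
  moreover have "{cylinder n x | n (x :: int \<Rightarrow> 'a). True} = (\<Union>n. range (cylinder n))"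
    by auto
  ultimately show ?thesis by simp
qed

text \<open>An open set is the union of the cylinders inside it, a countable union by
  \<open>countable_cylinders\<close>.\<close>

lemma borel_sigma_sets_cylinders:
  assumes "A \<in> sets (borel :: (int \<Rightarrow> 'a::{finite, discrete_topology}) measure)"
  shows "A \<in> sigma_sets UNIV {cylinder n x | n x. True}" (is "_ \<in> sigma_sets _ ?C")
proof -
  have "U \<in> sigma_sets UNIV ?C" if "open U" for U :: "(int \<Rightarrow> 'a) set"
  proof -
    have "U = \<Union>{c \<in> ?C. c \<subseteq> U}"
    proof (intro set_eqI iffI)
      fix x assume "x \<in> U"
      then obtain n where "cylinder n x \<subseteq> U"
        using open_contains_cylinder[OF \<open>open U\<close>] by blast
      moreover have "x \<in> cylinder n x" by (simp add: cylinder_def)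
      ultimately show "x \<in> \<Union>{c \<in> ?C. c \<subseteq> U}" by blast
    qed blast
    moreover have "countable {c \<in> ?C. c \<subseteq> U}"
      by (rule countable_subset[OF _ countable_cylinders]) auto
    ultimately show ?thesis
      by (metis (no_types, lifting) mem_Collect_eq sigma_sets.Basic sigma_sets_UNION)
  qed
  then have "sigma_sets UNIV {U :: (int \<Rightarrow> 'a) set. open U} \<subseteq> sigma_sets UNIV ?C"
    by (intro sigma_sets_mono) auto
  then show ?thesis
    using assms by (auto simp: borel_def)
qed

lemma borel_column_class:
  fixes F :: "(int \<Rightarrow> 'a::discrete_topology) \<Rightarrow> (int \<Rightarrow> 'a)"
  assumes "continuous_on UNIV F"
  shows "column_class F m x \<in> sets borel"
proof -
  have cont: "continuous_on UNIV (F ^^ i)" for i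
  proof (induction i)
    case (Suc i)
    have "continuous_on UNIV (\<lambda>x. F ((F ^^ i) x))"
      by (rule continuous_on_compose2[OF assms Suc]) simp
    then show ?case by (simp add: comp_def)
  qed (simp add: id_def)
  have "open ((F ^^ i) -` {y. y j = c})" for i j c
    using open_coordinate cont by (rule open_vimage)
  then have "(\<Inter>i. \<Inter>j\<in>{- int m..int m}. (F ^^ i) -` {y. y j = (F ^^ i) x j}) \<in> sets borel"
    by (intro sets.countable_INT'' sets.finite_INT borel_open) auto
  moreover have "column_class F m x = (\<Inter>i. \<Inter>j\<in>{- int m..int m}. (F ^^ i) -` {y. y j = (F ^^ i) x j})"
    by (auto simp: column_class_def)
  ultimately show ?thesis by simp
qed

lemma column_class_eq: "y \<in> column_class F m x \<Longrightarrow> column_class F m y = column_class F m x"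
  by (auto simp: column_class_def)

lemma column_class_self: "x \<in> column_class F m x"
  by (simp add: column_class_def)

text \<open>The ratios tend to 1, so one of them is positive; its numerator bounds the measure of
  the class from below.\<close>

lemma equicontinuous_point_column_class_pos:
  assumes "finite_measure M" "column_class F m x \<in> sets M" "equicontinuous_point M F x"
  shows "0 < measure M (column_class F m x)"
proof -
  interpret finite_measure M by fact
  have "(\<lambda>n. measure M (cylinder n x \<inter> column_class F m x) / measure M (cylinder n x)) \<longlonglongrightarrow> 1"
    using assms(3) by (simp add: equicontinuous_point_def)
  then have "\<forall>\<^sub>F n in sequentially.
      0 < measure M (cylinder n x \<inter> column_class F m x) / measure M (cylinder n x)"
    by (rule order_tendstoD) simp
  then obtain n where "0 < measure M (cylinder n x \<inter> column_class F m x) / measure M (cylinder n x)"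
    by (auto simp: eventually_sequentially)
  then have "0 < measure M (cylinder n x \<inter> column_class F m x)"
    by (simp add: zero_less_divide_iff)
  also have "\<dots> \<le> measure M (column_class F m x)"
    using assms(2) by (intro finite_measure_mono) auto
  finally show ?thesis .
qed

section \<open>From column classes to cylinders to all Borel sets\<close>

theorem proposition2p3:
  fixes F :: "(int \<Rightarrow> 'a::{finite, discrete_topology}) \<Rightarrow> (int \<Rightarrow> 'a)"
    and \<mu> :: "(int \<Rightarrow> 'a) measure"
  assumes "cellular_automaton F"
    and "prob_space \<mu>"
    and "sets \<mu> = sets borel"
    and "invariant_measure \<mu> F"
    and "equicontinuous_ca \<mu> F"
  shows "ks_entropy \<mu> F = 0"
proof -
  have cont: "continuous_on UNIV F"
    using assms(1) by (simp add: cellular_automaton_def)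
  then have "F \<in> measurable \<mu> \<mu>"
    using borel_measurable_continuous_onI[OF cont] measurable_cong_sets[OF assms(3,3)] by simp
  then interpret measure_preserving_system \<mu> F
    using assms(2,4) by (simp add: measure_preserving_system_def measure_preserving_system_axioms_def)
  have space: "space \<mu> = UNIV"
    using sets_eq_imp_space_eq[OF assms(3)] by simp
  have class_sets: "column_class F m x \<in> sets \<mu>" for m x
    using borel_column_class[OF cont] assms(3) by simp
  have cylinder_sets: "cylinder m x \<in> sets \<mu>" for m x
    using borel_cylinder assms(3) by simp
  have cylinder_zero: "zero_entropy (\<lambda>y. y \<in> cylinder m x)" for m x
  proof -
    \<comment> \<open>The classes use the same window \<open>m\<close> as the cylinder, so all
      points of a class visit \<open>cylinder m x\<close> at the same times. Collecting sets rather
      than points lists each class once.\<close>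
    define \<K> where "\<K> = {column_class F m y | y. 0 < prob (column_class F m y)}"
    have cover: "AE y in \<mu>. y \<in> \<Union>\<K>"
      using assms(5) unfolding equicontinuous_ca_def
    proof eventually_elim
      case (elim y)
      then have "0 < prob (column_class F m y)"
        by (intro equicontinuous_point_column_class_pos class_sets) unfold_locales
      then show ?case
        using column_class_self by (auto simp: \<K>_def)
    qed
    have "countable \<K>"
    proof (rule countable_disjoint_positive)
      show "disjoint \<K>"
        by (auto simp: \<K>_def disjoint_def dest: column_class_eq)
    qed (auto simp: \<K>_def class_sets)
    \<comment> \<open>An empty family cannot cover almost all of a probability space; nonemptiness
      lets \<open>from_nat_into\<close> enumerate exactly \<K>.\<close>
    moreover have "\<K> \<noteq> {}"
      using cover by (auto simp: AE_False)
    ultimately have \<K>: "range (from_nat_into \<K>) = \<K>"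
      by (rule range_from_nat_into[rotated])
    show ?thesis
    proof (rule zero_entropy_constant_on_cover[where K = "from_nat_into \<K>"])
      fix j i y z
      have "from_nat_into \<K> j \<in> \<K>" using \<K> by blast
      then obtain w where w: "from_nat_into \<K> j = column_class F m w"
        by (auto simp: \<K>_def)
      then show "from_nat_into \<K> j \<in> sets \<mu>" by (simp add: class_sets)
      assume "y \<in> from_nat_into \<K> j" "z \<in> from_nat_into \<K> j"
      then show "((F ^^ i) y \<in> cylinder m x) = ((F ^^ i) z \<in> cylinder m x)"
        by (simp add: w column_class_def cylinder_def)
    next
      show "AE y in \<mu>. y \<in> (\<Union>j. from_nat_into \<K> j)"
        using cover by (simp add: \<K>)
    qed (intro simple_function_mem cylinder_sets)
  qed
  show ?thesis
  proof (rule ks_entropy_eq_0)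
    fix A assume "A \<in> sets \<mu>"
    then have "A \<in> sigma_sets (space \<mu>) {cylinder n x | n x. True}"
      using borel_sigma_sets_cylinders[of A] assms(3) space by simp
    then show "zero_entropy (\<lambda>x. x \<in> A)"
      using zero_entropy_sigma_sets[of "{cylinder n x | n x. True}" A] cylinder_sets cylinder_zero
      by blast
  qed
qed

end
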